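(* Let $m,s$ be positive integers such that $m\geq s$. For any set $\mathcal{X}\subseteq\mathbb{T}$ of cardinality $s$ and any $\tau\in(0,\frac12]$ such that $m>\frac1\tau$, we have $$\sigma_1(\Phi(m,\mathcal{X}))\leq\sqrt{\nu(\tau,\mathcal{X})\left(m+\frac1\tau\right)}.$$
   Context: $\mathbb{T}:=\mathbb{R}/\mathbb{Z}$ and $|t|_{\mathbb{T}}:=\min_{n\in\mathbb{Z}}|t-n|$. For a set $\mathcal{X}=\{x_k\}_{k=1}^s\subseteq\mathbb{T}$ of cardinality $s$ and an integer $m\geq s$, the Fourier matrix is the $m\times s$ matrix $\Phi(m,\mathcal{X}):=[e^{-2\pi i j x_k}]_{j=0,\dots,m-1,\;k=1,\dots,s}$, and $\sigma_1(\Phi)$ denotes its largest singular value. For $\tau\in(0,\frac12]$, the $\tau$ local sparsity of a finite nonempty set $\mathcal{X}\subseteq\mathbb{T}$ is $\nu(\tau,\mathcal{X}):=\max_{x\in\mathcal{X}}|\{x'\in\mathcal{X}\colon|x-x'|_{\mathbb{T}}\leq\tau\}|$. *)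

theory Defs
  imports Complex_Main "Jordan_Normal_Form.Schur_Decomposition" "Jordan_Normal_Form.Spectral_Radius"
begin

section \<open>The additive group of reals modulo the integers\<close>

quotient_type circle = real / "\<lambda>a b. a - b \<in> \<int>"
proof (rule equivpI)
  show "reflp (\<lambda>a b::real. a - b \<in> \<int>)"
    by (simp add: reflp_def)
  show "symp (\<lambda>a b::real. a - b \<in> \<int>)"
    by (metis (mono_tags, lifting) Ints_minus minus_diff_eq sympI)
  show "transp (\<lambda>a b::real. a - b \<in> \<int>)"
  proof (rule transpI)
    fix a b c :: real
    assume "a - b \<in> \<int>" "b - c \<in> \<int>"
    then have "(a - b) + (b - c) \<in> \<int>" by (rule Ints_add)
    then show "a - c \<in> \<int>" by simp
  qed
qed

instantiation circle :: ab_group_add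
begin

lift_definition zero_circle :: circle is "0 :: real" .

lift_definition plus_circle :: "circle \<Rightarrow> circle \<Rightarrow> circle" is "(+)"
proof -
  fix a b c d :: real
  assume "a - b \<in> \<int>" "c - d \<in> \<int>"
  then have "(a - b) + (c - d) \<in> \<int>" by (rule Ints_add)
  then show "(a + c) - (b + d) \<in> \<int>" by (simp add: algebra_simps)
qed

lift_definition uminus_circle :: "circle \<Rightarrow> circle" is uminus
proof -
  fix a b :: real
  assume "a - b \<in> \<int>"
  then have "- (a - b) \<in> \<int>" by (rule Ints_minus)
  then show "- a - - b \<in> \<int>" by simp
qed

definition minus_circle :: "circle \<Rightarrow> circle \<Rightarrow> circle"
  where "minus_circle x y = x + - y"

instance
proof
  fix a b c :: circle
  show "a + b + c = a + (b + c)" by transfer (simp add: algebra_simps)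
  show "a + b = b + a" by transfer (simp add: algebra_simps)
  show "0 + a = a" by transfer simp
  show "- a + a = 0" by transfer simp
  show "a - b = a + - b" by (rule minus_circle_def)
qed

end

text \<open>The infimum is a minimum, see \<open>circle_norm_attained\<close>.\<close>

lift_definition circle_norm :: "circle \<Rightarrow> real" is "\<lambda>t. INF n::int. \<bar>t - of_int n\<bar>"
proof -
  fix a b :: real
  assume "a - b \<in> \<int>"
  then obtain k :: int where k: "a - b = of_int k" by (elim Ints_cases)
  have eq: "\<bar>a - of_int n\<bar> = \<bar>b - of_int (n - k)\<bar>" for n
    using k by (simp add: algebra_simps)
  have "range (\<lambda>n::int. \<bar>a - of_int n\<bar>) = range (\<lambda>n::int. \<bar>b - of_int n\<bar>)"
  proof (rule Set.set_eqI, rule iffI)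
    fix y assume "y \<in> range (\<lambda>n::int. \<bar>a - of_int n\<bar>)"
    then obtain n where "y = \<bar>a - of_int n\<bar>" by auto
    then have "y = \<bar>b - of_int (n - k)\<bar>" by (simp only: eq)
    then show "y \<in> range (\<lambda>n::int. \<bar>b - of_int n\<bar>)" by blast
  next
    fix y assume "y \<in> range (\<lambda>n::int. \<bar>b - of_int n\<bar>)"
    then obtain n where "y = \<bar>b - of_int n\<bar>" by auto
    then have "y = \<bar>a - of_int (n + k)\<bar>" using eq[of "n + k"] by simp
    then show "y \<in> range (\<lambda>n::int. \<bar>a - of_int n\<bar>)" by blast
  qed
  then show "(INF n::int. \<bar>a - of_int n\<bar>) = (INF n::int. \<bar>b - of_int n\<bar>)" by simp
qed

lemma circle_norm_abs: "circle_norm (abs_circle t) = \<bar>t - of_int (round t)\<bar>"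
proof -
  have "circle_norm (abs_circle t) = (INF n::int. \<bar>t - of_int n\<bar>)"
    by (rule circle_norm.abs_eq)
  also have "\<dots> = \<bar>t - of_int (round t)\<bar>"
    by (rule cInf_eq_minimum) (use round_diff_minimal in auto)
  finally show ?thesis .
qed

lemma circle_norm_attained:
  "\<exists>n::int. circle_norm (abs_circle t) = \<bar>t - of_int n\<bar> \<and> (\<forall>k::int. \<bar>t - of_int n\<bar> \<le> \<bar>t - of_int k\<bar>)"
  using circle_norm_abs round_diff_minimal by blast

lift_definition circle_exp :: "nat \<Rightarrow> circle \<Rightarrow> complex"
  is "\<lambda>j t. exp (- 2 * complex_of_real pi * \<i> * of_nat j * complex_of_real t)"
proof -
  fix j :: nat and a b :: real
  assume "a - b \<in> \<int>"
  then obtain k :: int where k: "a - b = of_int k" by (elim Ints_cases)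
  have a: "a = b + of_int k" using k by simp
  have "exp (- 2 * complex_of_real pi * \<i> * of_nat j * complex_of_real a) =
        exp (- 2 * complex_of_real pi * \<i> * of_nat j * complex_of_real b)
        * exp (\<i> * complex_of_real (2 * pi * of_int (- int j * k)))"
    unfolding exp_add[symmetric] by (simp add: a algebra_simps)
  also have "exp (\<i> * complex_of_real (2 * pi * of_int (- int j * k))) = 1"
    unfolding cis_conv_exp[symmetric] by (rule cis_multiple_2pi) (rule Ints_of_int)
  finally show "exp (- 2 * complex_of_real pi * \<i> * of_nat j * complex_of_real a) =
        exp (- 2 * complex_of_real pi * \<i> * of_nat j * complex_of_real b)" by simp
qed


section \<open>Local sparsity and Fourier matrices\<close>

definition local_sparsity :: "real \<Rightarrow> circle set \<Rightarrow> nat"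
  where "local_sparsity \<tau> X = Max ((\<lambda>x. card {x' \<in> X. circle_norm (x - x') \<le> \<tau>}) ` X)"

text \<open>The nodes are enumerated as \<open>x 0, \<dots>, x (s - 1)\<close>.\<close>

definition fourier_matrix :: "nat \<Rightarrow> nat \<Rightarrow> (nat \<Rightarrow> circle) \<Rightarrow> complex mat"
  where "fourier_matrix m s x = mat m s (\<lambda>(j, k). circle_exp j (x k))"


section \<open>Singular values\<close>

text \<open>
  The square roots of the eigenvalues of the Gram matrix \<open>A\<^sup>* A\<close>. If \<open>A\<close> has more columns
  than rows this may contribute an additional \<open>0\<close>, which does not affect the maximum.
\<close>

definition singular_values :: "complex mat \<Rightarrow> real set"
  where "singular_values A =
    {\<sigma>. 0 \<le> \<sigma> \<and> eigenvalue (mat_adjoint A * A) (complex_of_real (\<sigma>\<^sup>2))}"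

lemma finite_singular_values: "finite (singular_values A)"
proof -
  have B: "mat_adjoint A * A \<in> carrier_mat (dim_col A) (dim_col A)"
    by (rule carrier_matI) (simp_all add: mat_adjoint_def)
  have "inj_on (\<lambda>\<sigma>. complex_of_real (\<sigma>\<^sup>2)) (singular_values A)"
    by (rule inj_onI) (auto simp: singular_values_def simp flip: of_real_power)
  moreover have "(\<lambda>\<sigma>. complex_of_real (\<sigma>\<^sup>2)) ` singular_values A \<subseteq> spectrum (mat_adjoint A * A)"
    by (auto simp: singular_values_def spectrum_def)
  ultimately show ?thesis
    using card_finite_spectrum(1)[OF B] by (meson finite_imageD finite_subset)
qed

lemma singular_values_nonempty:
  assumes "0 < dim_col A"
  shows "singular_values A \<noteq> {}"
proof -
  define n where "n = dim_col A"
  define m where "m = dim_row A"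
  have A: "A \<in> carrier_mat m n" by (simp add: n_def m_def)
  define H where "H = mat_adjoint A"
  have H: "H \<in> carrier_mat n m" by (rule carrier_matI) (simp_all add: H_def mat_adjoint_def n_def m_def)
  have rowH: "row H i = conjugate (col A i)" if "i < n" for i
    using that by (simp add: H_def mat_adjoint_def n_def)
  have HA: "H * A \<in> carrier_mat n n" using H A by simp
  from spectrum_non_empty[OF HA] assms obtain l where l: "eigenvalue (H * A) l"
    unfolding spectrum_def n_def by auto
  then obtain v where v: "v \<in> carrier_vec n" "v \<noteq> 0\<^sub>v n" "(H * A) *\<^sub>v v = l \<cdot>\<^sub>v v"
    using HA unfolding eigenvalue_def eigenvector_def by auto
  define w where "w = A *\<^sub>v v"
  have w: "w \<in> carrier_vec m" using A v by (simp add: w_def)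
  have Hw: "H *\<^sub>v w = l \<cdot>\<^sub>v v"
    using v(3) assoc_mult_mat_vec[OF H A v(1)] by (simp add: w_def)
  have Hw_nth: "(H *\<^sub>v w) $ i = (\<Sum>j<m. cnj (A $$ (j,i)) * w $ j)" if "i < n" for i
    using that H A w by (simp add: rowH scalar_prod_def lessThan_atLeast0)
  have w_nth: "w $ j = (\<Sum>i<n. A $$ (j,i) * v $ i)" if "j < m" for j
    using that A v(1) by (simp add: w_def scalar_prod_def lessThan_atLeast0)
  have "(H *\<^sub>v w) \<bullet>c v = (\<Sum>i<n. (H *\<^sub>v w) $ i * cnj (v $ i))"
    using v(1) by (simp add: scalar_prod_def lessThan_atLeast0)
  also have "\<dots> = (\<Sum>i<n. (\<Sum>j<m. cnj (A $$ (j,i)) * w $ j) * cnj (v $ i))"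
    by (rule sum.cong) (simp_all only: Hw_nth lessThan_iff)
  also have "\<dots> = (\<Sum>i<n. \<Sum>j<m. w $ j * (cnj (A $$ (j,i)) * cnj (v $ i)))"
    by (simp add: sum_distrib_left sum_distrib_right mult_ac)
  also have "\<dots> = (\<Sum>j<m. \<Sum>i<n. w $ j * (cnj (A $$ (j,i)) * cnj (v $ i)))"
    by (rule sum.swap)
  also have "\<dots> = (\<Sum>j<m. w $ j * cnj (w $ j))"
  proof (rule sum.cong[OF refl])
    fix j assume "j \<in> {..<m}"
    then have "cnj (w $ j) = (\<Sum>i<n. cnj (A $$ (j,i)) * cnj (v $ i))"
      using w_nth[of j] by simp
    then show "(\<Sum>i<n. w $ j * (cnj (A $$ (j,i)) * cnj (v $ i))) = w $ j * cnj (w $ j)"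
      by (simp only: sum_distrib_left)
  qed
  also have "\<dots> = w \<bullet>c w"
    using w by (simp add: scalar_prod_def lessThan_atLeast0)
  finally have eq: "l * (v \<bullet>c v) = w \<bullet>c w"
    using v(1) by (simp add: Hw)
  have vv: "0 < v \<bullet>c v" using v by simp
  have ww: "0 \<le> w \<bullet>c w" using w by auto
  define a where "a = Re (v \<bullet>c v)"
  define b where "b = Re (w \<bullet>c w)"
  have a: "v \<bullet>c v = complex_of_real a" "0 < a"
    using vv by (auto simp: a_def less_complex_def complex_eq_iff)
  have b: "w \<bullet>c w = complex_of_real b" "0 \<le> b"
    using ww by (auto simp: b_def less_eq_complex_def complex_eq_iff)
  have "l = complex_of_real (b / a)"
    using eq a b by (simp add: field_simps)
  moreover have "b / a = (sqrt (b / a))\<^sup>2" using a b by simp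
  ultimately have "eigenvalue (H * A) (complex_of_real ((sqrt (b / a))\<^sup>2))"
    using l by metis
  then have "sqrt (b / a) \<in> singular_values A"
    unfolding singular_values_def H_def mem_Collect_eq
    using a(2) b(2) by (intro conjI real_sqrt_ge_zero divide_nonneg_pos)
  then show ?thesis by blast
qed

definition largest_singular_value :: "complex mat \<Rightarrow> real"
  where "largest_singular_value A = Max (singular_values A)"

end

theory Submission
  imports Defs "HOL-Analysis.Analysis"
begin

text \<open>
  Join two nodes of \<open>X\<close> when their distance is at most \<open>\<tau>\<close>. Every vertex of this graph has degree
  less than \<open>\<nu> = local_sparsity \<tau> X\<close>, so \<open>X\<close> splits greedily into \<open>\<nu>\<close> classes in which distinct nodes
  are more than \<open>\<tau>\<close> apart. For one class the squared norm of the Fourier matrix is at most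
  \<open>m + 1 / \<tau>\<close> by the large sieve, and the Cauchy-Schwarz inequality over the classes costs a factor \<open>\<nu>\<close>.

  The large sieve follows Montgomery and Vaughan: summing the geometric series turns the
  off-diagonal part of the Gram matrix into a difference of two forms with kernel
  \<open>csc (\<pi> (x r - x t)) / (2 \<i>)\<close>. The norm of the kernel \<open>csc (\<pi> (x r - x t))\<close> is attained at an
  eigenvector \<open>u\<close>. Expanding the squared norm of the image of \<open>u\<close> with
  \<open>csc \<alpha> csc \<beta> = csc (\<beta> - \<alpha>) (cot \<alpha> - cot \<beta>)\<close>, the eigenvector equation cancels the sums of cotangents,
  and what remains is controlled by \<open>\<Sum> (csc\<^sup>2 + 2 \<bar>csc cot\<bar>) \<le> 6 \<zeta>(2) / (\<pi>\<^sup>2 \<delta>\<^sup>2) = 1 / \<delta>\<^sup>2\<close>.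
\<close>

section \<open>Cosecant and cotangent sums over separated points\<close>

text \<open>Bounds a term \<open>csc\<^sup>2 + 2 \<bar>csc cot\<bar>\<close> of the row sums by
  \<open>3 / y\<^sup>2\<close>. The constant 3 is forced by \<open>y\<close> tending to 0, and it is
  what later makes the row sum exactly \<open>1 / \<delta>\<^sup>2\<close>.\<close>

lemma cos_sin_taylor_bound:
  fixes y :: real
  assumes "\<bar>y\<bar> \<le> pi / 2"
  shows "y\<^sup>2 * (1 + 2 * \<bar>cos y\<bar>) \<le> 3 * (sin y)\<^sup>2"
proof -
  have pos: "y\<^sup>2 * (1 + 2 * \<bar>cos y\<bar>) \<le> 3 * (sin y)\<^sup>2" if "0 < y" "y \<le> pi / 2" for y :: real
  proof -
    \<comment> \<open>The orders 4 here and 6 for the cosine are chosen for the sign of the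
      remainder: nonnegative for \<open>sin\<close> and nonpositive for \<open>cos\<close> on this
      range.\<close>
    have "\<exists>t. 0 < t \<and> t < y \<and> sin y = (\<Sum>k<4. sin_coeff k * y ^ k) + sin (t + 1/2 * real 4 * pi) / fact 4 * y ^ 4"
      by (rule Maclaurin_sin_expansion3) (use that in auto)
    then obtain t where t: "0 < t" "t < y" "sin y = (\<Sum>k<4. sin_coeff k * y ^ k) + sin (t + 1/2 * real 4 * pi) / fact 4 * y ^ 4" by blast
    have "sin (t + 1/2 * real 4 * pi) = sin t"
      using sin_periodic[of t] by (simp add: algebra_simps)
    moreover have "0 \<le> sin t" using t that pi_gt_zero by (intro sin_ge_zero) linarith+
    moreover have "(\<Sum>k<4. sin_coeff k * y ^ k) = y - y^3/6"
    proof -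
      have "{..<4} = {0, 1, 2, 3::nat}" by auto
      then show ?thesis by (simp add: sin_coeff_def fact_numeral)
    qed
    ultimately have s: "y - y^3/6 \<le> sin y" using t(3) that by simp
    have "\<exists>w. 0 < w \<and> w < y \<and> cos y = (\<Sum>k<6. cos_coeff k * y ^ k) + cos (w + 1/2 * real 6 * pi) / fact 6 * y ^ 6"
      by (rule Maclaurin_cos_expansion2) (use that in auto)
    then obtain w where w: "0 < w" "w < y" "cos y = (\<Sum>k<6. cos_coeff k * y ^ k) + cos (w + 1/2 * real 6 * pi) / fact 6 * y ^ 6" by blast
    have "cos (w + 1/2 * real 6 * pi) = - cos w"
      using cos_periodic[of "w + pi"] by (simp add: algebra_simps)
    moreover have "0 \<le> cos w" using w that pi_gt_zero by (intro cos_ge_zero) linarith+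
    moreover have "(\<Sum>k<6. cos_coeff k * y ^ k) = 1 - y^2/2 + y^4/24"
    proof -
      have "{..<6} = {0, 1, 2, 3, 4, 5::nat}" by auto
      then show ?thesis by (simp add: cos_coeff_def fact_numeral)
    qed
    ultimately have c: "cos y \<le> 1 - y^2/2 + y^4/24" using w(3) that by simp
    have c0: "0 \<le> cos y" using that pi_gt_zero by (intro cos_ge_zero) linarith+
    \<comment> \<open>The cubic has to be nonnegative before the lower bound for
      \<open>sin y\<close> may be squared.\<close>
    have "y \<le> 2" using that pi_half_less_two by linarith
    then have "y * y \<le> 2 * 2" using that by (intro mult_mono) auto
    then have "0 \<le> y * (1 - y\<^sup>2 / 6)" using that by (intro mult_nonneg_nonneg) (auto simp: power2_eq_square)
    then have "0 \<le> y - y^3/6" by (simp add: algebra_simps eval_nat_numeral)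
    then have "(y - y^3/6)\<^sup>2 \<le> (sin y)\<^sup>2" using s by (rule power_mono[rotated])
    moreover have "y\<^sup>2 * (1 + 2 * \<bar>cos y\<bar>) \<le> y\<^sup>2 * (1 + 2 * (1 - y^2/2 + y^4/24))"
      using c c0 by (intro mult_left_mono) auto
    moreover have "y\<^sup>2 * (1 + 2 * (1 - y^2/2 + y^4/24)) = 3 * (y - y^3/6)\<^sup>2"
      by (simp add: field_simps eval_nat_numeral)
    \<comment> \<open>The Taylor polynomials of \<open>sin\<close> and \<open>cos\<close> used as bounds satisfy the claim with equality.\<close>
    ultimately show ?thesis by linarith
  qed
  consider "y = 0" | "y > 0" | "y < 0" by linarith
  then show ?thesis
  proof cases
    case 2 then show ?thesis using pos[of y] assms by simp
  next
    case 3 then show ?thesis using pos[of "- y"] assms by simp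
  qed simp
qed

text \<open>After scaling by \<open>\<delta>\<close>, distinct points lie in distinct unit intervals
  \<open>[n, n + 1)\<close> with \<open>n \<ge> 1\<close>, so the sum is dominated by
  \<open>\<Sum> 1 / n\<^sup>2 = \<pi>\<^sup>2 / 6\<close>.\<close>

lemma sum_inverse_squares_separated:
  fixes y :: "'a \<Rightarrow> real"
  assumes "finite P" "0 < \<delta>"
    and ge: "\<And>s. s \<in> P \<Longrightarrow> \<delta> \<le> y s"
    and sep: "\<And>s t. s \<in> P \<Longrightarrow> t \<in> P \<Longrightarrow> s \<noteq> t \<Longrightarrow> \<delta> \<le> \<bar>y s - y t\<bar>"
  shows "(\<Sum>s\<in>P. 1 / (y s)\<^sup>2) \<le> pi\<^sup>2 / 6 / \<delta>\<^sup>2"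
proof -
  \<comment> \<open>The shift by 1 makes the indices start at 0, matching the series
    \<open>\<Sum> 1 / (n + 1)\<^sup>2\<close>.\<close>
  define k where "k s = nat \<lfloor>y s / \<delta>\<rfloor> - 1" for s
  have k: "real (k s) + 1 \<le> y s / \<delta>" "y s / \<delta> < real (k s) + 2" if "s \<in> P" for s
  proof -
    have "1 \<le> y s / \<delta>" using ge[OF that] \<open>0 < \<delta>\<close> by simp
    then have "1 \<le> \<lfloor>y s / \<delta>\<rfloor>" by (simp add: le_floor_iff)
    then have "real (k s) = real_of_int \<lfloor>y s / \<delta>\<rfloor> - 1"
      unfolding k_def by linarith
    then show "real (k s) + 1 \<le> y s / \<delta>" "y s / \<delta> < real (k s) + 2"
      by linarith+
  qed
  have inj: "inj_on k P"
  proof (rule inj_onI, rule ccontr)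
    fix s t assume st: "s \<in> P" "t \<in> P" "k s = k t" "s \<noteq> t"
    then have "\<bar>y s / \<delta> - y t / \<delta>\<bar> < 1" using k[of s] k[of t] by simp
    then have "\<bar>y s - y t\<bar> < \<delta>"
      using \<open>0 < \<delta>\<close> by (simp flip: diff_divide_distrib)
    with sep[OF st(1,2,4)] show False by simp
  qed
  have "(\<Sum>s\<in>P. 1 / (y s)\<^sup>2) \<le> (\<Sum>s\<in>P. 1 / \<delta>\<^sup>2 * (1 / (real (k s) + 1)\<^sup>2))"
  proof (rule sum_mono)
    fix s assume "s \<in> P"
    then have "(real (k s) + 1) * \<delta> \<le> y s"
      using k(1) \<open>0 < \<delta>\<close> by (simp add: pos_le_divide_eq)
    then have "((real (k s) + 1) * \<delta>)\<^sup>2 \<le> (y s)\<^sup>2"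
      using \<open>0 < \<delta>\<close> by (intro power_mono) auto
    then have "1 / (y s)\<^sup>2 \<le> 1 / ((real (k s) + 1) * \<delta>)\<^sup>2"
      using \<open>0 < \<delta>\<close> ge[OF \<open>s \<in> P\<close>]
      by (intro divide_left_mono mult_pos_pos zero_less_power) auto
    then show "1 / (y s)\<^sup>2 \<le> 1 / \<delta>\<^sup>2 * (1 / (real (k s) + 1)\<^sup>2)"
      by (simp add: power_mult_distrib mult.commute)
  qed
  also have "\<dots> = 1 / \<delta>\<^sup>2 * (\<Sum>n\<in>k ` P. 1 / (real n + 1)\<^sup>2)"
    by (simp add: sum.reindex[OF inj] sum_distrib_left)
  also have "(\<Sum>n\<in>k ` P. 1 / (real n + 1)\<^sup>2) \<le> pi\<^sup>2 / 6"
    using sum_le_suminf[OF sums_summable[OF inverse_squares_sums], of "k ` P"] \<open>finite P\<close>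
      sums_unique[OF inverse_squares_sums] by (simp add: add_ac)
  finally show ?thesis by (simp add: mult_left_mono divide_right_mono)
qed

text \<open>Integer shifts of \<open>x r - x t\<close> change neither \<open>sin\<^sup>2\<close> nor
  \<open>\<bar>cos\<bar>\<close>, so each difference may be replaced by its representative
  \<open>d t\<close> in \<open>[-1/2, 1/2]\<close>, where the Taylor bound applies.\<close>

lemma csc_cot_row_bound:
  fixes x :: "'a \<Rightarrow> real"
  assumes "finite K" "0 < \<delta>" "r \<in> K"
    and sep: "\<And>s t n. s \<in> K \<Longrightarrow> t \<in> K \<Longrightarrow> s \<noteq> t \<Longrightarrow> \<delta> \<le> \<bar>x s - x t - of_int n\<bar>"
  shows "(\<Sum>t\<in>K - {r}. (1 + 2 * \<bar>cos (pi * (x r - x t))\<bar>) / (sin (pi * (x r - x t)))\<^sup>2) \<le> 1 / \<delta>\<^sup>2"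
proof -
  define n where "n t = round (x r - x t)" for t
  define d where "d t = x r - x t - of_int (n t)" for t
  have ge: "\<delta> \<le> \<bar>d t\<bar>" if "t \<in> K - {r}" for t
    using sep[of r t "n t"] that \<open>r \<in> K\<close> by (auto simp: d_def)
  have half: "\<bar>d t\<bar> \<le> 1 / 2" for t
    using of_int_round_abs_le[of "x r - x t"] by (simp add: d_def n_def abs_minus_commute)
  have dist: "\<delta> \<le> \<bar>d s - d t\<bar>" if "s \<in> K" "t \<in> K" "s \<noteq> t" for s t
    using sep[of t s "n s - n t"] that by (simp add: d_def algebra_simps)
  have "(\<Sum>t\<in>K - {r}. (1 + 2 * \<bar>cos (pi * (x r - x t))\<bar>) / (sin (pi * (x r - x t)))\<^sup>2)
      \<le> (\<Sum>t\<in>K - {r}. 3 / pi\<^sup>2 * (1 / (d t)\<^sup>2))"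
  proof (rule sum_mono)
    fix t assume t: "t \<in> K - {r}"
    have e: "pi * (x r - x t) = pi * d t + pi * of_int (n t)"
      by (simp add: d_def algebra_simps)
    have c: "\<bar>cos (pi * (x r - x t))\<bar> = \<bar>cos (pi * d t)\<bar>"
      unfolding e cos_add by simp
    have s: "(sin (pi * (x r - x t)))\<^sup>2 = (sin (pi * d t))\<^sup>2"
      unfolding e sin_add by simp
    have "\<bar>pi * d t\<bar> \<le> pi / 2" using half[of t] by (simp add: abs_mult)
    then have b: "(pi * d t)\<^sup>2 * (1 + 2 * \<bar>cos (pi * d t)\<bar>) \<le> 3 * (sin (pi * d t))\<^sup>2"
      by (rule cos_sin_taylor_bound)
    have d0: "0 < (pi * d t)\<^sup>2" using ge[OF t] \<open>0 < \<delta>\<close> by auto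
    have "0 < (pi * d t)\<^sup>2 * (1 + 2 * \<bar>cos (pi * d t)\<bar>)"
      using d0 by (intro mult_pos_pos) auto
    with b have "0 < (sin (pi * d t))\<^sup>2" by linarith
    with b d0 have "(1 + 2 * \<bar>cos (pi * d t)\<bar>) / (sin (pi * d t))\<^sup>2 \<le> 3 / (pi * d t)\<^sup>2"
      by (simp add: divide_le_eq le_divide_eq mult_ac)
    then show "(1 + 2 * \<bar>cos (pi * (x r - x t))\<bar>) / (sin (pi * (x r - x t)))\<^sup>2 \<le> 3 / pi\<^sup>2 * (1 / (d t)\<^sup>2)"
      unfolding c s by (simp add: power_mult_distrib)
  qed
  also have "\<dots> = 3 / pi\<^sup>2 * (\<Sum>t\<in>K - {r}. 1 / (d t)\<^sup>2)"
    by (simp only: sum_distrib_left)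
  also have "\<dots> \<le> 3 / pi\<^sup>2 * (pi\<^sup>2 / 3 / \<delta>\<^sup>2)"
  proof (rule mult_left_mono)
    \<comment> \<open>The representatives to the right and to the left of 0 are treated separately;
      each side contributes at most \<open>\<pi>\<^sup>2 / 6 / \<delta>\<^sup>2\<close>.\<close>
    let ?P = "{t \<in> K - {r}. 0 < d t}" and ?N = "{t \<in> K - {r}. \<not> 0 < d t}"
    have P: "\<delta> \<le> d t" if "t \<in> ?P" for t using ge[of t] that by auto
    have N: "\<delta> \<le> - d t" if "t \<in> ?N" for t using ge[of t] that by auto
    have "(\<Sum>t\<in>?P. 1 / (d t)\<^sup>2) \<le> pi\<^sup>2 / 6 / \<delta>\<^sup>2"
      using \<open>finite K\<close> \<open>0 < \<delta>\<close> P dist by (intro sum_inverse_squares_separated) auto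
    moreover have "(\<Sum>t\<in>?N. 1 / (- d t)\<^sup>2) \<le> pi\<^sup>2 / 6 / \<delta>\<^sup>2"
      using \<open>finite K\<close> \<open>0 < \<delta>\<close> N dist
      by (intro sum_inverse_squares_separated) (auto simp: abs_minus_commute)
    moreover have "(\<Sum>t\<in>K - {r}. 1 / (d t)\<^sup>2) = (\<Sum>t\<in>?P. 1 / (d t)\<^sup>2) + (\<Sum>t\<in>?N. 1 / (- d t)\<^sup>2)"
    proof -
      have "?P \<union> ?N = K - {r}" by auto
      then show ?thesis
        using \<open>finite K\<close> sum.union_disjoint[of ?P ?N "\<lambda>t. 1 / (d t)\<^sup>2"] by auto
    qed
    ultimately show "(\<Sum>t\<in>K - {r}. 1 / (d t)\<^sup>2) \<le> pi\<^sup>2 / 3 / \<delta>\<^sup>2" by simp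
  qed simp
  finally show ?thesis by simp
qed

section \<open>Greedy colouring\<close>

text \<open>Vertices are coloured one at a time. By reflexivity the count bounded by
  \<open>\<nu>\<close> includes the vertex itself, so a new vertex has fewer than
  \<open>\<nu>\<close> coloured neighbours and some colour is free.\<close>

lemma exists_proper_coloring:
  fixes R :: "'a \<Rightarrow> 'a \<Rightarrow> bool" and \<nu> :: nat
  assumes "finite X" and refl: "\<And>x. R x x" and sym: "\<And>x y. R x y \<Longrightarrow> R y x"
    and deg: "\<And>x. x \<in> X \<Longrightarrow> card {y \<in> X. R x y} \<le> \<nu>"
  shows "\<exists>c :: 'a \<Rightarrow> nat. c ` X \<subseteq> {..<\<nu>} \<and> (\<forall>x\<in>X. \<forall>y\<in>X. x \<noteq> y \<longrightarrow> R x y \<longrightarrow> c x \<noteq> c y)"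
  using \<open>finite X\<close> deg
proof (induction X rule: finite_induct)
  case (insert x F)
  have degF: "card {y \<in> F. R z y} \<le> \<nu>" if "z \<in> F" for z
  proof -
    have "card {y \<in> F. R z y} \<le> card {y \<in> insert x F. R z y}"
      using \<open>finite F\<close> by (intro card_mono) auto
    also have "\<dots> \<le> \<nu>" by (rule insert.prems) (use that in blast)
    finally show ?thesis .
  qed
  have "\<exists>c. c ` F \<subseteq> {..<\<nu>} \<and> (\<forall>y\<in>F. \<forall>z\<in>F. y \<noteq> z \<longrightarrow> R y z \<longrightarrow> c y \<noteq> c z)"
    by (rule insert.IH) (rule degF)
  then obtain c where c: "c ` F \<subseteq> {..<\<nu>} \<and> (\<forall>y\<in>F. \<forall>z\<in>F. y \<noteq> z \<longrightarrow> R y z \<longrightarrow> c y \<noteq> c z)" ..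
  let ?B = "{y \<in> F. R x y}"
  have "{y \<in> insert x F. R x y} = insert x ?B" using refl[of x] by auto
  then have "card ?B < \<nu>"
    using insert.prems[OF insertI1] \<open>finite F\<close> \<open>x \<notin> F\<close> by simp
  then have "card (c ` ?B) < card {..<\<nu>}"
    using card_image_le[of ?B c] \<open>finite F\<close> by simp
  then obtain a where a: "a < \<nu>" "a \<notin> c ` ?B"
    using card_mono[of "c ` ?B" "{..<\<nu>}"] \<open>finite F\<close> by force
  have "(c(x := a)) ` insert x F \<subseteq> {..<\<nu>}" using c a(1) by auto
  moreover have "(c(x := a)) y \<noteq> (c(x := a)) z"
    if "y \<in> insert x F" "z \<in> insert x F" "y \<noteq> z" "R y z" for y z
    using that conjunct2[OF c] a(2) sym[of y z] \<open>x \<notin> F\<close> by (auto simp: image_iff)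
  ultimately show ?case by blast
qed auto

section \<open>The top eigenvalue of a Hermitian kernel\<close>

text \<open>The Hermitian form attains its maximum on the compact unit sphere, and a maximiser is an
  eigenvector whose eigenvalue is that maximum.\<close>

lemma hermitian_max_eigenvector:
  fixes h :: "'a \<Rightarrow> 'a \<Rightarrow> complex"
  assumes fin: "finite K" and ne: "K \<noteq> {}"
    and herm: "\<And>r t. r \<in> K \<Longrightarrow> t \<in> K \<Longrightarrow> h t r = cnj (h r t)"
  obtains u :: "'a \<Rightarrow> complex" and \<mu> :: real
  where "(\<Sum>r\<in>K. (cmod (u r))\<^sup>2) = 1"
    and "\<And>r. r \<in> K \<Longrightarrow> (\<Sum>t\<in>K. h r t * u t) = \<mu> * u r"
    and "\<And>v. Re (\<Sum>r\<in>K. cnj (v r) * (\<Sum>t\<in>K. h r t * v t)) \<le> \<mu> * (\<Sum>r\<in>K. (cmod (v r))\<^sup>2)"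
proof -
  define q where "q v = Re (\<Sum>r\<in>K. cnj (v r) * (\<Sum>t\<in>K. h r t * v t))" for v
  define N where "N v = (\<Sum>r\<in>K. (cmod (v r))\<^sup>2)" for v :: "'a \<Rightarrow> complex"
  \<comment> \<open>Coordinates outside \<open>K\<close> are pinned to 0, so \<open>C\<close> is a
    product of compact sets and compact by Tychonoff's theorem, even if the index type is
    infinite.\<close>
  define C :: "('a \<Rightarrow> complex) set"
    where "C = PiE UNIV (\<lambda>r. if r \<in> K then cball 0 1 else {0})"
  have coord: "continuous_on UNIV (\<lambda>v::'a \<Rightarrow> complex. v r)" for r
    by (rule continuous_on_product_coordinates)
  have contN: "continuous_on UNIV N"
    unfolding N_def by (intro continuous_intros coord)
  have contq: "continuous_on UNIV q"
    unfolding q_def by (intro continuous_intros coord)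
  have "compactin (product_topology (\<lambda>_. euclidean) UNIV) C"
    unfolding C_def compactin_PiE by (auto simp: compactin_euclidean_iff)
  then have "compact C"
    by (simp add: euclidean_product_topology compactin_euclidean_iff)
  moreover have "closed (N -` {1})"
    using contN by (intro closed_vimage) auto
  ultimately have comp: "compact (C \<inter> N -` {1})" by (rule compact_Int_closed)
  obtain r0 where "r0 \<in> K" using ne by blast
  then have "(\<lambda>r. if r = r0 then 1 else 0) \<in> C \<inter> N -` {1}"
    using fin by (auto simp: C_def N_def if_distrib[of "\<lambda>z. (cmod z)\<^sup>2"] cong: if_cong)
  then obtain u where u: "u \<in> C" "N u = 1" and max: "\<And>v. v \<in> C \<Longrightarrow> N v = 1 \<Longrightarrow> q v \<le> q u"
    using continuous_attains_sup[OF comp _ continuous_on_subset[OF contq]] by (metis IntD1 IntD2 IntI empty_iff subset_UNIV vimage_singleton_eq)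
  define \<mu> where "\<mu> = q u"
  have bound: "q v \<le> \<mu> * N v" for v
  proof (cases "N v = 0")
    case True
    then have "\<And>r. r \<in> K \<Longrightarrow> v r = 0"
      unfolding N_def using fin by (subst (asm) sum_nonneg_eq_0_iff) auto
    then have "q v = 0" by (simp add: q_def)
    with True show ?thesis by simp
  next
    case False
    have "0 \<le> N v" unfolding N_def by (rule sum_nonneg) simp
    with False have Nv: "0 < N v" by simp
    \<comment> \<open>By homogeneity \<open>v\<close> may be rescaled to norm one and cut off
      outside \<open>K\<close>, which puts it into \<open>C\<close>.\<close>
    define c where "c = inverse (sqrt (N v))"
    have c2: "c * c = inverse (N v)"
      using Nv unfolding c_def by (simp flip: inverse_mult_distrib)
    define w where "w r = (if r \<in> K then c * v r else 0)" for r
    have Nw: "N w = 1"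
    proof -
      have "N w = (\<Sum>r\<in>K. (c * c) * (cmod (v r))\<^sup>2)"
        unfolding N_def by (rule sum.cong) (simp_all add: w_def norm_mult power2_eq_square mult_ac flip: abs_mult)
      also have "\<dots> = 1" using Nv c2 by (simp add: N_def flip: sum_distrib_left)
      finally show ?thesis .
    qed
    have "w \<in> C"
    proof -
      have "cmod (w r) \<le> 1" if "r \<in> K" for r
      proof -
        have "(cmod (w r))\<^sup>2 \<le> N w"
          unfolding N_def using fin that by (intro member_le_sum) auto
        then show ?thesis using Nw by (simp add: power_le_one_iff abs_square_le_1)
      qed
      then show ?thesis by (auto simp: C_def w_def)
    qed
    have "q w = Re (\<Sum>r\<in>K. complex_of_real (c * c) * (cnj (v r) * (\<Sum>t\<in>K. h r t * v t)))"
      unfolding q_def by (intro arg_cong[where f = Re] sum.cong refl)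
        (auto simp: w_def sum_distrib_left mult_ac intro!: sum.cong)
    also have "\<dots> = inverse (N v) * q v"
    proof -
      have "Re (complex_of_real a * z) = a * Re z" for a z by simp
      then show ?thesis by (simp only: q_def c2 flip: sum_distrib_left)
    qed
    finally have "inverse (N v) * q v \<le> \<mu>"
      using max[OF \<open>w \<in> C\<close> Nw] by (simp add: \<mu>_def)
    then show ?thesis using Nv by (simp add: field_simps)
  qed
  define g where "g r = (\<Sum>t\<in>K. h r t * u t) - \<mu> * u r" for r
  \<comment> \<open>First-order optimality: moving from \<open>u\<close> along the residual \<open>g\<close> would increase the quotient.\<close>
  have var: "2 * \<epsilon> * N g \<le> \<epsilon>\<^sup>2 * (\<mu> * N g - q g)" for \<epsilon> :: real
  proof -
    define v where "v r = u r + \<epsilon> * g r" for r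
    define G where "G = Re (\<Sum>r\<in>K. cnj (g r) * (\<Sum>t\<in>K. h r t * u t))"
    \<comment> \<open>Hermitian symmetry makes the two cross terms conjugate, so together they
      contribute \<open>2 * \<epsilon> * G\<close>.\<close>
    have swap: "(\<Sum>r\<in>K. cnj (u r) * (\<Sum>t\<in>K. h r t * g t)) = cnj (\<Sum>r\<in>K. cnj (g r) * (\<Sum>t\<in>K. h r t * u t))"
    proof -
      have "(\<Sum>r\<in>K. cnj (u r) * (\<Sum>t\<in>K. h r t * g t)) = (\<Sum>t\<in>K. \<Sum>r\<in>K. cnj (u r) * (h r t * g t))"
        unfolding sum_distrib_left by (rule sum.swap)
      also have "\<dots> = (\<Sum>t\<in>K. \<Sum>r\<in>K. cnj (cnj (g t) * (h t r * u r)))"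
      proof (intro sum.cong refl)
        fix t r assume "t \<in> K" "r \<in> K"
        then have "h r t = cnj (h t r)" by (rule herm)
        then show "cnj (u r) * (h r t * g t) = cnj (cnj (g t) * (h t r * u r))" by (simp add: mult_ac)
      qed
      finally show ?thesis by (simp add: sum_distrib_left)
    qed
    have "q v = Re ((\<Sum>r\<in>K. cnj (u r) * (\<Sum>t\<in>K. h r t * u t))
        + \<epsilon> * (\<Sum>r\<in>K. cnj (u r) * (\<Sum>t\<in>K. h r t * g t))
        + \<epsilon> * (\<Sum>r\<in>K. cnj (g r) * (\<Sum>t\<in>K. h r t * u t))
        + \<epsilon> * \<epsilon> * (\<Sum>r\<in>K. cnj (g r) * (\<Sum>t\<in>K. h r t * g t)))"
      unfolding q_def v_def
      by (rule arg_cong[where f = Re]) (simp add: algebra_simps sum.distrib sum_distrib_left)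
    moreover have "Re (a + \<epsilon> * cnj z + \<epsilon> * z + \<epsilon> * \<epsilon> * w) = Re a + 2 * \<epsilon> * Re z + \<epsilon>\<^sup>2 * Re w" for a z w :: complex
      by (simp add: power2_eq_square)
    ultimately have qv: "q v = \<mu> + 2 * \<epsilon> * G + \<epsilon>\<^sup>2 * q g"
      by (simp only: swap \<mu>_def G_def q_def)
    have nm: "(cmod z)\<^sup>2 = Re (cnj z * z)" for z
      unfolding cmod_power2 by (simp add: power2_eq_square)
    have Nv: "N v = 1 + 2 * \<epsilon> * Re (\<Sum>r\<in>K. cnj (g r) * u r) + \<epsilon>\<^sup>2 * N g"
    proof -
      have "N v = N u + 2 * \<epsilon> * Re (\<Sum>r\<in>K. cnj (g r) * u r) + \<epsilon>\<^sup>2 * N g"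
        unfolding N_def v_def nm Re_sum sum_distrib_left sum.distrib[symmetric]
        by (intro sum.cong refl) (simp add: algebra_simps power2_eq_square)
      with u show ?thesis by simp
    qed
    \<comment> \<open>Since \<open>g\<close> is the residual of the eigenvector equation, the
      coefficient of \<open>\<epsilon>\<close> is exactly \<open>2 * N g\<close>.\<close>
    have "G - \<mu> * Re (\<Sum>r\<in>K. cnj (g r) * u r) = N g"
    proof -
      have "G - \<mu> * Re (\<Sum>r\<in>K. cnj (g r) * u r) = Re (\<Sum>r\<in>K. cnj (g r) * (\<Sum>t\<in>K. h r t * u t) - \<mu> * (cnj (g r) * u r))"
        by (simp add: G_def sum_subtractf flip: sum_distrib_left)
      also have "\<dots> = Re (\<Sum>r\<in>K. cnj (g r) * g r)"
        by (intro arg_cong[where f = Re] sum.cong refl) (simp add: g_def algebra_simps)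
      finally show ?thesis by (simp only: N_def nm Re_sum)
    qed
    then show ?thesis using bound[of v] unfolding qv Nv by (simp add: algebra_simps)
  qed
  have "N g = 0"
  proof (rule ccontr)
    assume "N g \<noteq> 0"
    moreover have "0 \<le> N g" unfolding N_def by (rule sum_nonneg) simp
    ultimately have Ng: "0 < N g" by simp
    define c where "c = \<mu> * N g - q g"
    \<comment> \<open>Taking \<open>\<epsilon> = 1\<close> shows \<open>c > 0\<close>; then
      \<open>\<epsilon> = N g / c\<close> is small enough for the linear term to beat the quadratic
      one.\<close>
    have c: "2 * N g \<le> c" using var[of 1] by (simp add: c_def)
    then have "2 * (N g / c) * N g \<le> (N g / c)\<^sup>2 * c" using var[of "N g / c"] by (simp add: c_def)
    moreover have "0 < c" using c Ng by linarith
    ultimately have "2 * (N g)\<^sup>2 \<le> (N g)\<^sup>2" by (simp add: power2_eq_square divide_le_cancel)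
    with Ng show False by simp
  qed
  then have "g r = 0" if "r \<in> K" for r
    unfolding N_def using fin that by (subst (asm) sum_nonneg_eq_0_iff) auto
  then show ?thesis using that[of u \<mu>] u bound by (simp add: N_def q_def g_def)
qed

section \<open>Hilbert's inequality with the cosecant kernel\<close>

lemma cot_diff:
  fixes a b :: real
  assumes "sin a \<noteq> 0" "sin b \<noteq> 0"
  shows "cot a - cot b = sin (b - a) * inverse (sin a) * inverse (sin b)"
  using assms by (simp add: cot_def sin_diff field_simps)

text \<open>The cosecant kernel is real and antisymmetric, so multiplying it by \<open>\<i>\<close>
  gives a Hermitian kernel \<open>h\<close>. It then suffices to bound the top eigenvalue
  \<open>\<mu>\<close> of \<open>h\<close> by \<open>1 / \<delta>\<close>.\<close>

lemma hilbert_inequality_csc: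
  fixes x :: "'a \<Rightarrow> real" and v :: "'a \<Rightarrow> complex"
  assumes fin: "finite K" and "0 < \<delta>"
    and sep: "\<And>s t n. s \<in> K \<Longrightarrow> t \<in> K \<Longrightarrow> s \<noteq> t \<Longrightarrow> \<delta> \<le> \<bar>x s - x t - of_int n\<bar>"
  shows "cmod (\<Sum>r\<in>K. \<Sum>t\<in>K. cnj (v r) * v t * complex_of_real (inverse (sin (pi * (x r - x t)))))
    \<le> 1 / \<delta> * (\<Sum>r\<in>K. (cmod (v r))\<^sup>2)"
proof (cases "K = {}")
  case False
  \<comment> \<open>Both kernels vanish on the diagonal, since \<open>inverse 0 = 0\<close> and \<open>cot 0 = 0\<close>.\<close>
  define a where "a r t = inverse (sin (pi * (x r - x t)))" for r t
  define c where "c r t = cot (pi * (x r - x t))" for r t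
  define h where "h r t = \<i> * complex_of_real (a r t)" for r t
  define S where "S v = (\<Sum>r\<in>K. \<Sum>t\<in>K. cnj (v r) * v t * complex_of_real (a r t))" for v :: "'a \<Rightarrow> complex"
  have diag: "a r r = 0" "c r r = 0" for r by (simp_all add: a_def c_def cot_def)
  have anti_a: "a t r = - a r t" for r t
  proof -
    have "pi * (x t - x r) = - (pi * (x r - x t))" by (simp add: algebra_simps)
    then show ?thesis unfolding a_def by (simp only: sin_minus inverse_minus_eq)
  qed
  have anti_c: "c t r = - c r t" for r t
  proof -
    have "pi * (x t - x r) = - (pi * (x r - x t))" by (simp add: algebra_simps)
    then show ?thesis unfolding c_def cot_def by (simp only: sin_minus cos_minus minus_divide_right)
  qed
  have nz: "sin (pi * (x r - x t)) \<noteq> 0" if "r \<in> K" "t \<in> K" "r \<noteq> t" for r t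
  proof
    assume "sin (pi * (x r - x t)) = 0"
    then obtain n :: int where "pi * (x r - x t) = of_int n * pi"
      unfolding sin_zero_iff_int2 by blast
    then have "x r - x t = of_int n" by simp
    with sep[OF that, of n] \<open>0 < \<delta>\<close> show False by simp
  qed
  have "h t r = cnj (h r t)" for r t using anti_a[of t r] by (simp add: h_def)
  then obtain u :: "'a \<Rightarrow> complex" and \<mu> :: real
    where u1: "(\<Sum>r\<in>K. (cmod (u r))\<^sup>2) = 1"
    and eig: "\<And>r. r \<in> K \<Longrightarrow> (\<Sum>t\<in>K. h r t * u t) = \<mu> * u r"
    and max: "\<And>v. Re (\<Sum>r\<in>K. cnj (v r) * (\<Sum>t\<in>K. h r t * v t)) \<le> \<mu> * (\<Sum>r\<in>K. (cmod (v r))\<^sup>2)"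
    using hermitian_max_eigenvector[OF fin False, of h] by blast
  have eig_a: "(\<Sum>t\<in>K. a r t * u t) = - \<i> * \<mu> * u r" if "r \<in> K" for r
  proof -
    have "\<i> * (\<Sum>t\<in>K. a r t * u t) = \<mu> * u r"
      using eig[OF that] by (simp add: h_def sum_distrib_left mult_ac)
    then have "- \<i> * (\<i> * (\<Sum>t\<in>K. a r t * u t)) = - \<i> * (\<mu> * u r)" by simp
    then show ?thesis by (simp flip: mult.assoc)
  qed
  have eig_cnj: "(\<Sum>t\<in>K. a r t * cnj (u t)) = \<i> * \<mu> * cnj (u r)" if "r \<in> K" for r
    using arg_cong[OF eig_a[OF that], of cnj] by simp
  define C where "C r = (\<Sum>s\<in>K. c s r)" for r
  define D where "D r = (\<Sum>s\<in>K. (a s r)\<^sup>2)" for r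
  have gram: "(\<Sum>s\<in>K. a s r * a s t) = (if r = t then D r else 0) + a r t * (C r - C t) + 2 * (a r t * c r t)"
    if "r \<in> K" "t \<in> K" for r t
  proof (cases "r = t")
    case True
    then show ?thesis by (simp add: D_def diag power2_eq_square)
  next
    case False
    \<comment> \<open>For \<open>s\<close> other than \<open>r\<close> and \<open>t\<close> this is
      the cosecant product identity. At \<open>s = r\<close> and \<open>s = t\<close> the left side
      is 0, while the cotangent difference leaves \<open>- a r t * c r t\<close>, which the two
      extra terms compensate.\<close>
    have "a s r * a s t = a r t * (c s r - c s t) + (if s = r then a r t * c r t else 0) + (if s = t then a r t * c r t else 0)"
      if s: "s \<in> K" for s
    proof (cases "s = r \<or> s = t")
      case True
      then show ?thesis using False anti_c[of t r] by (auto simp: diag)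
    next
      case s': False
      have "c s r - c s t = sin (pi * (x r - x t)) * a s r * a s t"
        unfolding c_def a_def
        using cot_diff[of "pi * (x s - x r)" "pi * (x s - x t)"] nz[of s r] nz[of s t] s s' \<open>r \<in> K\<close> \<open>t \<in> K\<close>
        by (simp add: algebra_simps)
      then show ?thesis
        using s' nz[OF \<open>r \<in> K\<close> \<open>t \<in> K\<close> False] by (simp add: a_def)
    qed
    then have "(\<Sum>s\<in>K. a s r * a s t) = (\<Sum>s\<in>K. a r t * (c s r - c s t) + (if s = r then a r t * c r t else 0) + (if s = t then a r t * c r t else 0))"
      by (rule sum.cong[OF refl])
    also have "\<dots> = a r t * (C r - C t) + 2 * (a r t * c r t)"
      using fin that by (simp add: sum.distrib C_def sum_subtractf flip: sum_distrib_left)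
    finally show ?thesis using False by simp
  qed
  \<comment> \<open>The squared norm of the image of the unit vector \<open>u\<close> is
    \<open>\<mu>\<^sup>2\<close>; it is now expanded through \<open>gram\<close>.\<close>
  have "complex_of_real (\<mu>\<^sup>2) = (\<Sum>s\<in>K. (\<Sum>r\<in>K. a s r * u r) * (\<Sum>t\<in>K. a s t * cnj (u t)))"
  proof -
    have "(\<Sum>s\<in>K. (\<Sum>r\<in>K. a s r * u r) * (\<Sum>t\<in>K. a s t * cnj (u t))) = (\<Sum>s\<in>K. complex_of_real (\<mu>\<^sup>2 * (cmod (u s))\<^sup>2))"
      by (rule sum.cong[OF refl], subst eig_a, assumption, subst eig_cnj, assumption)
        (simp add: power2_eq_square complex_norm_square mult_ac flip: complex_norm_square[unfolded power2_eq_square])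
    also have "\<dots> = complex_of_real (\<mu>\<^sup>2 * (\<Sum>r\<in>K. (cmod (u r))\<^sup>2))"
      by (simp only: of_real_sum sum_distrib_left)
    finally show ?thesis by (simp add: u1)
  qed
  also have "\<dots> = (\<Sum>s\<in>K. \<Sum>r\<in>K. \<Sum>t\<in>K. u r * cnj (u t) * of_real (a s r * a s t))"
    unfolding sum_product by (simp add: mult_ac)
  also have "\<dots> = (\<Sum>r\<in>K. \<Sum>s\<in>K. \<Sum>t\<in>K. u r * cnj (u t) * of_real (a s r * a s t))"
    by (rule sum.swap)
  also have "\<dots> = (\<Sum>r\<in>K. \<Sum>t\<in>K. \<Sum>s\<in>K. u r * cnj (u t) * of_real (a s r * a s t))"
    by (intro sum.cong refl sum.swap)
  also have "\<dots> = (\<Sum>r\<in>K. \<Sum>t\<in>K. u r * cnj (u t) * of_real (\<Sum>s\<in>K. a s r * a s t))"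
    by (simp only: of_real_sum sum_distrib_left)
  \<comment> \<open>Writing \<open>- a r t\<close> as \<open>a t r\<close> next to
    \<open>C t\<close> prepares both cotangent terms for the eigenvector equation: the inner sum
    runs over \<open>t\<close> in one and over \<open>r\<close> in the other.\<close>
  also have "\<dots> = (\<Sum>r\<in>K. \<Sum>t\<in>K. u r * cnj (u t) * of_real (if r = t then D r else 0)
      + C r * u r * (a r t * cnj (u t)) + C t * cnj (u t) * (a t r * u r) + 2 * (u r * cnj (u t) * of_real (a r t * c r t)))"
  proof (intro sum.cong refl)
    fix r t assume "r \<in> K" "t \<in> K"
    then show "u r * cnj (u t) * of_real (\<Sum>s\<in>K. a s r * a s t) = u r * cnj (u t) * of_real (if r = t then D r else 0)
      + C r * u r * (a r t * cnj (u t)) + C t * cnj (u t) * (a t r * u r) + 2 * (u r * cnj (u t) * of_real (a r t * c r t))"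
      unfolding gram[OF \<open>r \<in> K\<close> \<open>t \<in> K\<close>] anti_a[of t r] by (simp add: algebra_simps)
  qed
  also have "\<dots> = (\<Sum>r\<in>K. of_real (D r * (cmod (u r))\<^sup>2)) + (\<Sum>r\<in>K. C r * u r * (\<Sum>t\<in>K. a r t * cnj (u t)))
     + (\<Sum>t\<in>K. C t * cnj (u t) * (\<Sum>r\<in>K. a t r * u r)) + 2 * (\<Sum>r\<in>K. \<Sum>t\<in>K. u r * cnj (u t) * of_real (a r t * c r t))"
  proof -
    have "(\<Sum>t\<in>K. u r * cnj (u t) * of_real (if r = t then D r else 0)) = of_real (D r * (cmod (u r))\<^sup>2)" if "r \<in> K" for r
    proof -
      have "(\<Sum>t\<in>K. u r * cnj (u t) * of_real (if r = t then D r else 0)) = (\<Sum>t\<in>K. if t = r then u r * cnj (u r) * of_real (D r) else 0)"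
        by (intro sum.cong) auto
      then show ?thesis using that fin by (simp add: complex_norm_square mult_ac flip: of_real_power)
    qed
    moreover have "(\<Sum>r\<in>K. \<Sum>t\<in>K. C t * cnj (u t) * (a t r * u r)) = (\<Sum>t\<in>K. C t * cnj (u t) * (\<Sum>r\<in>K. a t r * u r))"
      unfolding sum_distrib_left by (rule sum.swap)
    ultimately show ?thesis by (simp add: sum.distrib sum_distrib_left)
  qed
  \<comment> \<open>The conjugated equation contributes the factor \<open>\<i> * \<mu>\<close> and
    the original one \<open>- \<i> * \<mu>\<close>, so the two cotangent sums cancel.\<close>
  also have "(\<Sum>r\<in>K. C r * u r * (\<Sum>t\<in>K. a r t * cnj (u t))) = (\<Sum>r\<in>K. \<i> * \<mu> * C r * (u r * cnj (u r)))"
    by (intro sum.cong refl) (simp add: eig_cnj)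
  also have "(\<Sum>t\<in>K. C t * cnj (u t) * (\<Sum>r\<in>K. a t r * u r)) = - (\<Sum>r\<in>K. \<i> * \<mu> * C r * (u r * cnj (u r)))"
    unfolding sum_negf[symmetric] by (intro sum.cong refl) (simp add: eig_a)
  finally have "complex_of_real (\<mu>\<^sup>2) = of_real (\<Sum>r\<in>K. D r * (cmod (u r))\<^sup>2) + 2 * (\<Sum>r\<in>K. \<Sum>t\<in>K. u r * cnj (u t) * of_real (a r t * c r t))"
    by simp
  from arg_cong[OF this, of Re]
  have "\<mu>\<^sup>2 = (\<Sum>r\<in>K. D r * (cmod (u r))\<^sup>2) + 2 * Re (\<Sum>r\<in>K. \<Sum>t\<in>K. u r * cnj (u t) * of_real (a r t * c r t))"
    by (simp only: Re_complex_of_real plus_complex.simps) (simp only: mult_2 plus_complex.simps)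
  \<comment> \<open>This uses \<open>2 * p * q \<le> p\<^sup>2 + q\<^sup>2\<close> for the moduli.
    As \<open>\<bar>a r t * c r t\<bar>\<close> is symmetric, both squares then collect the same row
    sum.\<close>
  also have "2 * Re (\<Sum>r\<in>K. \<Sum>t\<in>K. u r * cnj (u t) * of_real (a r t * c r t))
      \<le> (\<Sum>r\<in>K. \<Sum>t\<in>K. ((cmod (u r))\<^sup>2 + (cmod (u t))\<^sup>2) * \<bar>a r t * c r t\<bar>)"
    unfolding Re_sum sum_distrib_left
  proof (intro sum_mono)
    fix r t
    have "Re (u r * cnj (u t) * of_real (a r t * c r t)) \<le> cmod (u r) * cmod (u t) * \<bar>a r t * c r t\<bar>"
      using complex_Re_le_cmod[of "u r * cnj (u t) * of_real (a r t * c r t)"] by (simp add: norm_mult abs_mult)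
    moreover have "2 * (cmod (u r) * cmod (u t)) * \<bar>a r t * c r t\<bar> \<le> ((cmod (u r))\<^sup>2 + (cmod (u t))\<^sup>2) * \<bar>a r t * c r t\<bar>"
      using sum_squares_bound[of "cmod (u r)" "cmod (u t)"] by (intro mult_right_mono) (auto simp: mult_ac)
    ultimately show "2 * Re (u r * cnj (u t) * of_real (a r t * c r t)) \<le> ((cmod (u r))\<^sup>2 + (cmod (u t))\<^sup>2) * \<bar>a r t * c r t\<bar>"
      by linarith
  qed
  also have "\<dots> = (\<Sum>r\<in>K. (\<Sum>t\<in>K. 2 * \<bar>a r t * c r t\<bar>) * (cmod (u r))\<^sup>2)"
  proof -
    have "(\<Sum>r\<in>K. \<Sum>t\<in>K. (cmod (u t))\<^sup>2 * \<bar>a r t * c r t\<bar>) = (\<Sum>t\<in>K. \<Sum>r\<in>K. (cmod (u t))\<^sup>2 * \<bar>a t r * c t r\<bar>)"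
      by (subst sum.swap, intro sum.cong refl) (metis anti_a anti_c minus_mult_minus)
    moreover have "(\<Sum>r\<in>K. (\<Sum>t\<in>K. 2 * \<bar>a r t * c r t\<bar>) * (cmod (u r))\<^sup>2)
        = (\<Sum>r\<in>K. \<Sum>t\<in>K. (cmod (u r))\<^sup>2 * \<bar>a r t * c r t\<bar>) + (\<Sum>r\<in>K. \<Sum>t\<in>K. (cmod (u r))\<^sup>2 * \<bar>a r t * c r t\<bar>)"
      unfolding sum.distrib[symmetric] sum_distrib_right by (intro sum.cong refl) simp
    ultimately show ?thesis
      by (simp only: distrib_right sum.distrib)
  qed
  also have "(\<Sum>r\<in>K. D r * (cmod (u r))\<^sup>2) + (\<Sum>r\<in>K. (\<Sum>t\<in>K. 2 * \<bar>a r t * c r t\<bar>) * (cmod (u r))\<^sup>2)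
      = (\<Sum>r\<in>K. (D r + (\<Sum>t\<in>K. 2 * \<bar>a r t * c r t\<bar>)) * (cmod (u r))\<^sup>2)"
    by (simp add: distrib_right sum.distrib)
  also have "\<dots> \<le> (\<Sum>r\<in>K. 1 / \<delta>\<^sup>2 * (cmod (u r))\<^sup>2)"
  proof (intro sum_mono mult_right_mono)
    fix r assume r: "r \<in> K"
    have "D r + (\<Sum>t\<in>K. 2 * \<bar>a r t * c r t\<bar>) = (\<Sum>t\<in>K. (a r t)\<^sup>2 + 2 * \<bar>a r t * c r t\<bar>)"
      unfolding D_def anti_a[of _ r] by (simp add: sum.distrib)
    also have "\<dots> = (\<Sum>t\<in>K - {r}. (a r t)\<^sup>2 + 2 * \<bar>a r t * c r t\<bar>)"
      using fin r by (subst sum.remove[of K r]) (simp_all add: diag)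
    also have "\<dots> = (\<Sum>t\<in>K - {r}. (1 + 2 * \<bar>cos (pi * (x r - x t))\<bar>) / (sin (pi * (x r - x t)))\<^sup>2)"
    proof (intro sum.cong refl)
      fix t
      let ?s = "sin (pi * (x r - x t))" and ?c = "cos (pi * (x r - x t))"
      have "a r t * c r t = ?c / ?s\<^sup>2"
        by (simp add: a_def c_def cot_def divide_inverse power2_eq_square)
      moreover have "(a r t)\<^sup>2 = 1 / ?s\<^sup>2"
        by (simp add: a_def divide_inverse power_inverse)
      ultimately show "(a r t)\<^sup>2 + 2 * \<bar>a r t * c r t\<bar> = (1 + 2 * \<bar>?c\<bar>) / ?s\<^sup>2"
        by (simp add: add_divide_distrib)
    qed
    also have "\<dots> \<le> 1 / \<delta>\<^sup>2"
      by (rule csc_cot_row_bound[OF fin \<open>0 < \<delta>\<close> r sep])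
    finally show "D r + (\<Sum>t\<in>K. 2 * \<bar>a r t * c r t\<bar>) \<le> 1 / \<delta>\<^sup>2" .
  qed simp
  also have "\<dots> = (1 / \<delta>)\<^sup>2"
    by (simp add: u1 power_divide flip: sum_divide_distrib)
  finally have "\<mu> \<le> 1 / \<delta>"
    using \<open>0 < \<delta>\<close> by (intro power2_le_imp_le[of \<mu>]) auto
  moreover have "(\<Sum>r\<in>K. cnj (v r) * (\<Sum>t\<in>K. h r t * v t)) = \<i> * S v" for v
    by (simp add: S_def h_def sum_distrib_left mult_ac)
  ultimately have bound: "- Im (S v) \<le> 1 / \<delta> * (\<Sum>r\<in>K. (cmod (v r))\<^sup>2)" for v
    using max[of v] mult_right_mono[of \<mu> "1 / \<delta>" "\<Sum>r\<in>K. (cmod (v r))\<^sup>2"] by (simp add: sum_nonneg)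
  have anti_S: "(\<Sum>r\<in>K. \<Sum>t\<in>K. v r * cnj (v t) * complex_of_real (a r t)) = - S v" for v
  proof -
    have "(\<Sum>r\<in>K. \<Sum>t\<in>K. v r * cnj (v t) * complex_of_real (a r t))
        = (\<Sum>t\<in>K. \<Sum>r\<in>K. - (cnj (v t) * v r * complex_of_real (a t r)))"
      by (subst sum.swap, intro sum.cong refl, subst anti_a) (simp add: mult_ac)
    then show ?thesis by (simp add: S_def sum_negf)
  qed
  \<comment> \<open>\<open>S v\<close> is purely imaginary, and conjugating the entries of
    \<open>v\<close> flips its sign, so the one-sided bound on \<open>- Im (S v)\<close> controls
    the modulus.\<close>
  have "cnj (S v) = - S v"
    unfolding anti_S[symmetric] by (simp add: S_def)
  then have "Re (S v) = 0" by (simp add: complex_eq_iff)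
  moreover have "S (\<lambda>r. cnj (v r)) = - S v"
    using anti_S[of v] by (simp add: S_def)
  then have "Im (S v) \<le> 1 / \<delta> * (\<Sum>r\<in>K. (cmod (v r))\<^sup>2)"
    using bound[of "\<lambda>r. cnj (v r)"] by simp
  ultimately have "cmod (S v) \<le> 1 / \<delta> * (\<Sum>r\<in>K. (cmod (v r))\<^sup>2)"
    using bound[of v] by (simp add: cmod_def)
  then show ?thesis by (simp add: S_def a_def)
qed simp

section \<open>The large sieve in dual form\<close>

text \<open>Multiplication by \<open>2 \<i> sin (\<pi> y) = cis (\<pi> y) - cis (- \<pi> y)\<close>
  makes the geometric sum telescope over half-integer frequencies.\<close>

lemma dirichlet_kernel_csc:
  fixes y :: real
  assumes "sin (pi * y) \<noteq> 0"
  shows "(\<Sum>j<m. cis (2 * pi * real j * y))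
    = (cis (2 * pi * (real m - 1 / 2) * y) - cis (- (pi * y))) * complex_of_real (inverse (sin (pi * y))) / (2 * \<i>)"
proof -
  let ?s = "complex_of_real (sin (pi * y))"
  have s: "2 * \<i> * ?s = cis (pi * y) - cis (- (pi * y))"
    by (simp add: complex_eq_iff)
  have "(\<Sum>j<m. cis (2 * pi * real j * y)) * (2 * \<i> * ?s)
      = (\<Sum>j<m. cis (2 * pi * (real (Suc j) - 1 / 2) * y) - cis (2 * pi * (real j - 1 / 2) * y))"
    unfolding s sum_distrib_right
    by (intro sum.cong refl) (simp add: right_diff_distrib cis_mult algebra_simps)
  also have "\<dots> = cis (2 * pi * (real m - 1 / 2) * y) - cis (2 * pi * (real 0 - 1 / 2) * y)"
    by (rule sum_lessThan_telescope)
  also have "\<dots> = cis (2 * pi * (real m - 1 / 2) * y) - cis (- (pi * y))"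
    by simp
  finally have "(\<Sum>j<m. cis (2 * pi * real j * y)) * (2 * \<i> * ?s) = cis (2 * pi * (real m - 1 / 2) * y) - cis (- (pi * y))" .
  then show ?thesis using assms by (simp add: field_simps)
qed

text \<open>Expanding the square gives \<open>m\<close> times the squared norm from the diagonal.
  The rest is half the modulus of a difference of two cosecant forms at most, each bounded by
  Hilbert's inequality, so the two halves add up to a single \<open>1 / \<delta>\<close>.\<close>

lemma dual_large_sieve:
  fixes x :: "'a \<Rightarrow> real" and u :: "'a \<Rightarrow> complex"
  assumes fin: "finite K" and "0 < \<delta>"
    and sep: "\<And>s t n. s \<in> K \<Longrightarrow> t \<in> K \<Longrightarrow> s \<noteq> t \<Longrightarrow> \<delta> \<le> \<bar>x s - x t - of_int n\<bar>"
  shows "(\<Sum>j<m. (cmod (\<Sum>k\<in>K. u k * cis (- (2 * pi * real j * x k))))\<^sup>2)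
    \<le> (real m + 1 / \<delta>) * (\<Sum>k\<in>K. (cmod (u k))\<^sup>2)"
proof -
  define a where "a r t = complex_of_real (inverse (sin (pi * (x r - x t))))" for r t
  \<comment> \<open>The unimodular twists \<open>v\<close> and \<open>w\<close> absorb the two
    exponentials at the ends of the telescoped Dirichlet kernel without changing the norm of
    \<open>u\<close>.\<close>
  define v where "v k = u k * cis (- (2 * pi * (real m - 1 / 2) * x k))" for k
  define w where "w k = u k * cis (pi * x k)" for k
  define B where "B z = (\<Sum>r\<in>K. \<Sum>t\<in>K. cnj (z r) * z t * a r t)" for z :: "'a \<Rightarrow> complex"
  define U where "U = (\<Sum>k\<in>K. (cmod (u k))\<^sup>2)"
  have B: "cmod (B v) \<le> 1 / \<delta> * U" "cmod (B w) \<le> 1 / \<delta> * U"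
    using hilbert_inequality_csc[OF fin \<open>0 < \<delta>\<close> sep, where v = v] hilbert_inequality_csc[OF fin \<open>0 < \<delta>\<close> sep, where v = w]
    by (simp_all add: B_def a_def U_def v_def w_def norm_mult)
  \<comment> \<open>On the diagonal \<open>a r r = 0\<close>, because \<open>inverse 0 = 0\<close>,
    so one formula covers both cases.\<close>
  have kernel: "cnj (u r) * u t * (\<Sum>j<m. cis (2 * pi * real j * (x r - x t)))
      = (if r = t then of_nat m * (cmod (u r))\<^sup>2 else 0) + (cnj (v r) * v t * a r t - cnj (w r) * w t * a r t) / (2 * \<i>)"
    if "r \<in> K" "t \<in> K" for r t
  proof (cases "r = t")
    case True
    then show ?thesis by (simp add: a_def complex_norm_square mult_ac flip: of_real_power)
  next
    case False
    have "sin (pi * (x r - x t)) \<noteq> 0"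
    proof
      assume "sin (pi * (x r - x t)) = 0"
      then obtain n :: int where "pi * (x r - x t) = of_int n * pi"
        unfolding sin_zero_iff_int2 by blast
      then have "x r - x t = of_int n" by simp
      with sep[OF that False, of n] \<open>0 < \<delta>\<close> show False by simp
    qed
    note * = dirichlet_kernel_csc[OF this, of m, folded a_def]
    have v_eq: "cnj (v r) * v t = cnj (u r) * u t * cis (2 * pi * (real m - 1 / 2) * (x r - x t))"
      by (simp add: v_def cis_cnj cis_mult algebra_simps)
    have w_eq: "cnj (w r) * w t = cnj (u r) * u t * cis (- (pi * (x r - x t)))"
      by (simp add: w_def cis_cnj cis_mult algebra_simps)
    have "p * ((c - d) * e / b) = 0 + (p * c * e - p * d * e) / b" for p c d e b :: complex
      by (simp add: algebra_simps diff_divide_distrib)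
    then show ?thesis using False by (simp only: * v_eq w_eq if_False of_real_0)
  qed
  have "complex_of_real (\<Sum>j<m. (cmod (\<Sum>k\<in>K. u k * cis (- (2 * pi * real j * x k))))\<^sup>2)
      = (\<Sum>j<m. \<Sum>r\<in>K. \<Sum>t\<in>K. cnj (u r) * u t * cis (2 * pi * real j * (x r - x t)))"
    unfolding of_real_sum complex_norm_square
  proof (intro sum.cong refl)
    fix j
    show "(\<Sum>k\<in>K. u k * cis (- (2 * pi * real j * x k))) * cnj (\<Sum>k\<in>K. u k * cis (- (2 * pi * real j * x k)))
      = (\<Sum>r\<in>K. \<Sum>t\<in>K. cnj (u r) * u t * cis (2 * pi * real j * (x r - x t)))"
      unfolding cnj_sum sum_product
      by (subst sum.swap, intro sum.cong refl) (simp add: cis_cnj cis_mult algebra_simps)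
  qed
  also have "\<dots> = (\<Sum>r\<in>K. \<Sum>j<m. \<Sum>t\<in>K. cnj (u r) * u t * cis (2 * pi * real j * (x r - x t)))"
    by (rule sum.swap)
  also have "\<dots> = (\<Sum>r\<in>K. \<Sum>t\<in>K. cnj (u r) * u t * (\<Sum>j<m. cis (2 * pi * real j * (x r - x t))))"
    unfolding sum_distrib_left by (intro sum.cong refl sum.swap)
  also have "\<dots> = (\<Sum>r\<in>K. \<Sum>t\<in>K. (if r = t then of_nat m * (cmod (u r))\<^sup>2 else 0)
      + (cnj (v r) * v t * a r t - cnj (w r) * w t * a r t) / (2 * \<i>))"
    by (intro sum.cong refl kernel)
  also have "\<dots> = of_nat m * U + (B v - B w) / (2 * \<i>)"
  proof -
    have "(\<Sum>r\<in>K. \<Sum>t\<in>K. if r = t then real m * (cmod (u r))\<^sup>2 else 0) = real m * U"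
      using fin by (simp add: U_def sum_distrib_left)
    then have "(\<Sum>r\<in>K. \<Sum>t\<in>K. complex_of_real (if r = t then real m * (cmod (u r))\<^sup>2 else 0)) = complex_of_real (real m * U)"
      by (simp only: flip: of_real_sum)
    moreover have "(\<Sum>r\<in>K. \<Sum>t\<in>K. (cnj (v r) * v t * a r t - cnj (w r) * w t * a r t) / (2 * \<i>)) = (B v - B w) / (2 * \<i>)"
      by (simp only: B_def sum_subtractf flip: sum_divide_distrib)
    ultimately show ?thesis by (simp only: sum.distrib)
  qed
  finally have *: "complex_of_real (\<Sum>j<m. (cmod (\<Sum>k\<in>K. u k * cis (- (2 * pi * real j * x k))))\<^sup>2)
      = of_nat m * U + (B v - B w) / (2 * \<i>)" .
  have "(\<Sum>j<m. (cmod (\<Sum>k\<in>K. u k * cis (- (2 * pi * real j * x k))))\<^sup>2) = real m * U + Re ((B v - B w) / (2 * \<i>))"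
    using arg_cong[OF *, of Re] by (simp only: Re_complex_of_real plus_complex.simps)
  also have "Re ((B v - B w) / (2 * \<i>)) \<le> cmod ((B v - B w) / (2 * \<i>))"
    by (rule complex_Re_le_cmod)
  also have "\<dots> \<le> (cmod (B v) + cmod (B w)) / 2"
    using norm_triangle_ineq4[of "B v" "B w"] by (simp add: norm_divide norm_mult)
  also have "\<dots> \<le> 1 / \<delta> * U" using add_mono[OF B] by (simp add: mult.commute)
  finally show ?thesis by (simp add: U_def distrib_right)
qed

section \<open>Norm and singular values of the Fourier matrix\<close>

lemma fourier_matrix_norm_bound:
  fixes m s :: nat and X :: "circle set" and x :: "nat \<Rightarrow> circle" and v :: "nat \<Rightarrow> complex"
  assumes X: "bij_betw x {..<s} X" and "0 < \<tau>"
  shows "(\<Sum>j<m. (cmod (\<Sum>k<s. circle_exp j (x k) * v k))\<^sup>2)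
    \<le> real (local_sparsity \<tau> X) * (real m + 1 / \<tau>) * (\<Sum>k<s. (cmod (v k))\<^sup>2)"
proof -
  define \<nu> where "\<nu> = local_sparsity \<tau> X"
  define R where "R k l \<longleftrightarrow> circle_norm (x k - x l) \<le> \<tau>" for k l
  \<comment> \<open>Real representatives of the nodes: the circle distance is at most
    \<open>\<bar>y k - y l - n\<bar>\<close> for every integer \<open>n\<close>, with equality for
    some \<open>n\<close>.\<close>
  define y where "y k = rep_circle (x k)" for k
  have abs_y: "abs_circle (y k) = x k" for k
    by (simp add: y_def Quotient3_abs_rep[OF Quotient3_circle])
  have xy: "x k - x l = abs_circle (y k - y l)" for k l
    by (simp add: minus_circle_def plus_circle.abs_eq uminus_circle.abs_eq flip: abs_y)
  have norm_le: "circle_norm (x k - x l) \<le> \<bar>y k - y l - of_int n\<bar>" for k l n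
    unfolding xy circle_norm_abs by (rule round_diff_minimal)
  have Rrefl: "R k k" for k
    using norm_le[of k k 0] \<open>0 < \<tau>\<close> by (simp add: R_def)
  have Rsym: "R l k" if "R k l" for k l
  proof -
    obtain n :: int where "circle_norm (x k - x l) = \<bar>y k - y l - of_int n\<bar>"
      using circle_norm_attained[of "y k - y l"] unfolding xy by blast
    then show ?thesis
      using norm_le[of l k "- n"] that by (simp add: R_def abs_minus_commute algebra_simps)
  qed
  have inj: "inj_on x {..<s}" and img: "x ` {..<s} = X" using X by (auto simp: bij_betw_def)
  have deg: "card {l \<in> {..<s}. R k l} \<le> \<nu>" if "k \<in> {..<s}" for k
  proof -
    have "{x' \<in> X. circle_norm (x k - x') \<le> \<tau>} = x ` {l \<in> {..<s}. R k l}"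
      using img by (auto simp: R_def)
    then have "card {l \<in> {..<s}. R k l} = card {x' \<in> X. circle_norm (x k - x') \<le> \<tau>}"
      by (simp only: card_image[OF inj_on_subset[OF inj Collect_restrict]])
    also have "\<dots> \<le> \<nu>"
      unfolding \<nu>_def local_sparsity_def using img that by (intro Max_ge) auto
    finally show ?thesis .
  qed
  obtain c :: "nat \<Rightarrow> nat" where c: "c ` {..<s} \<subseteq> {..<\<nu>}"
    "\<forall>k\<in>{..<s}. \<forall>l\<in>{..<s}. k \<noteq> l \<longrightarrow> R k l \<longrightarrow> c k \<noteq> c l"
    using exists_proper_coloring[of "{..<s}" R \<nu>, OF _ Rrefl Rsym deg] by blast
  define K where "K i = {k \<in> {..<s}. c k = i}" for i
  define T where "T i j = (\<Sum>k\<in>K i. circle_exp j (x k) * v k)" for i j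
  have split: "(\<Sum>k<s. f k) = (\<Sum>i<\<nu>. \<Sum>k\<in>K i. f k)" for f :: "nat \<Rightarrow> 'b::comm_monoid_add"
    unfolding K_def using c(1) by (intro sum.group[symmetric]) auto
  have char: "circle_exp j (x k) = cis (- (2 * pi * real j * y k))" for j k
    unfolding abs_y[symmetric] circle_exp.abs_eq cis_conv_exp by (simp add: mult_ac)
  have cls: "(\<Sum>j<m. (cmod (T i j))\<^sup>2) \<le> (real m + 1 / \<tau>) * (\<Sum>k\<in>K i. (cmod (v k))\<^sup>2)" for i
  proof -
    \<comment> \<open>Distinct nodes of one colour are not related by \<open>R\<close>, so their
      circle distance exceeds \<open>\<tau>\<close>, and so does every integer shift of the
      difference of representatives.\<close>
    have "\<tau> \<le> \<bar>y k - y l - of_int n\<bar>" if "k \<in> K i" "l \<in> K i" "k \<noteq> l" for k l n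
      using norm_le[of k l n] that c(2) by (fastforce simp: K_def R_def)
    then show ?thesis
      unfolding T_def char mult.commute[of "cis _"]
      using \<open>0 < \<tau>\<close> by (intro dual_large_sieve) (auto simp: K_def)
  qed
  have "(\<Sum>j<m. (cmod (\<Sum>k<s. circle_exp j (x k) * v k))\<^sup>2) = (\<Sum>j<m. (cmod (\<Sum>i<\<nu>. T i j))\<^sup>2)"
    unfolding split T_def ..
  also have "\<dots> \<le> (\<Sum>j<m. real \<nu> * (\<Sum>i<\<nu>. (cmod (T i j))\<^sup>2))"
  proof (rule sum_mono)
    fix j
    \<comment> \<open>Cauchy-Schwarz against the all-ones vector of length
      \<open>\<nu>\<close>.\<close>
    have "(cmod (\<Sum>i<\<nu>. T i j))\<^sup>2 \<le> (\<Sum>i<\<nu>. 1 * cmod (T i j))\<^sup>2"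
      by (intro power_mono) (simp_all add: norm_sum)
    also have "\<dots> \<le> (\<Sum>i<\<nu>. 1\<^sup>2) * (\<Sum>i<\<nu>. (cmod (T i j))\<^sup>2)"
      by (rule Cauchy_Schwarz_ineq_sum)
    finally show "(cmod (\<Sum>i<\<nu>. T i j))\<^sup>2 \<le> real \<nu> * (\<Sum>i<\<nu>. (cmod (T i j))\<^sup>2)" by simp
  qed
  also have "\<dots> = real \<nu> * (\<Sum>i<\<nu>. \<Sum>j<m. (cmod (T i j))\<^sup>2)"
    unfolding sum_distrib_left[symmetric] by (simp only: sum.swap[of _ "{..<m}"])
  also have "\<dots> \<le> real \<nu> * (\<Sum>i<\<nu>. (real m + 1 / \<tau>) * (\<Sum>k\<in>K i. (cmod (v k))\<^sup>2))"
    by (intro mult_left_mono sum_mono cls) simp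
  also have "\<dots> = real \<nu> * (real m + 1 / \<tau>) * (\<Sum>k<s. (cmod (v k))\<^sup>2)"
    unfolding split by (simp only: sum_distrib_left mult.assoc)
  finally show ?thesis unfolding \<nu>_def .
qed

text \<open>For an eigenvector \<open>v\<close> of the Gram matrix with eigenvalue
  \<open>\<sigma>\<^sup>2\<close>, the squared norm of \<open>A v\<close> equals
  \<open>\<sigma>\<^sup>2\<close> times that of \<open>v\<close>; testing the norm bound at this
  \<open>v\<close> gives the claim.\<close>

lemma singular_value_le:
  fixes A :: "complex mat"
  assumes A: "A \<in> carrier_mat m n" and \<sigma>: "\<sigma> \<in> singular_values A"
    and bound: "\<And>v. (\<Sum>j<m. (cmod (\<Sum>k<n. A $$ (j, k) * v k))\<^sup>2) \<le> b * (\<Sum>k<n. (cmod (v k))\<^sup>2)"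
  shows "\<sigma> \<le> sqrt b"
proof -
  define H where "H = mat_adjoint A"
  have H: "H \<in> carrier_mat n m" using A by (intro carrier_matI) (simp_all add: H_def mat_adjoint_def)
  have H_nth: "H $$ (k, j) = cnj (A $$ (j, k))" if "k < n" "j < m" for j k
    using that A by (simp add: H_def mat_adjoint_def mat_of_rows_def)
  have HA: "H * A \<in> carrier_mat n n" using H A by simp
  obtain v where v: "v \<in> carrier_vec n" "v \<noteq> 0\<^sub>v n" "(H * A) *\<^sub>v v = complex_of_real (\<sigma>\<^sup>2) \<cdot>\<^sub>v v"
    using \<sigma> HA unfolding singular_values_def eigenvalue_def eigenvector_def H_def by auto
  define w where "w j = (\<Sum>k<n. A $$ (j, k) * v $ k)" for j
  define Av where "Av = A *\<^sub>v v"
  have Av: "Av \<in> carrier_vec m" using A v(1) by (simp add: Av_def)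
  have Av_nth: "Av $ j = w j" if "j < m" for j
    using that A v(1) by (simp add: Av_def w_def scalar_prod_def lessThan_atLeast0)
  have Hw: "(\<Sum>j<m. cnj (A $$ (j, k)) * w j) = complex_of_real (\<sigma>\<^sup>2) * v $ k" if k: "k < n" for k
  proof -
    have "(\<Sum>j<m. cnj (A $$ (j, k)) * w j) = (H *\<^sub>v Av) $ k"
      using k Av H by (simp add: scalar_prod_def lessThan_atLeast0 H_nth Av_nth)
    also have "H *\<^sub>v Av = complex_of_real (\<sigma>\<^sup>2) \<cdot>\<^sub>v v"
      using v(3) assoc_mult_mat_vec[OF H A v(1)] by (simp add: Av_def)
    finally show ?thesis using k v(1) by simp
  qed
  define V where "V = (\<Sum>k<n. (cmod (v $ k))\<^sup>2)"
  have "complex_of_real (\<Sum>j<m. (cmod (w j))\<^sup>2) = (\<Sum>j<m. cnj (w j) * w j)"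
    by (simp add: complex_norm_square mult.commute flip: of_real_power)
  also have "\<dots> = (\<Sum>j<m. \<Sum>k<n. cnj (v $ k) * (cnj (A $$ (j, k)) * w j))"
    by (intro sum.cong refl) (subst (1) w_def, simp add: sum_distrib_left sum_distrib_right mult_ac)
  also have "\<dots> = (\<Sum>k<n. \<Sum>j<m. cnj (v $ k) * (cnj (A $$ (j, k)) * w j))"
    by (rule sum.swap)
  also have "\<dots> = (\<Sum>k<n. cnj (v $ k) * (complex_of_real (\<sigma>\<^sup>2) * v $ k))"
    by (intro sum.cong refl) (simp only: Hw lessThan_iff flip: sum_distrib_left)
  also have "\<dots> = complex_of_real (\<sigma>\<^sup>2 * V)"
    by (simp add: V_def complex_norm_square sum_distrib_left mult_ac flip: of_real_power)
  finally have "(\<Sum>j<m. (cmod (w j))\<^sup>2) = \<sigma>\<^sup>2 * V" by (simp only: of_real_eq_iff)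
  moreover have "(\<Sum>j<m. (cmod (w j))\<^sup>2) \<le> b * V"
    unfolding w_def V_def by (rule bound)
  moreover have "0 < V"
  proof -
    obtain k where "k < n" "v $ k \<noteq> 0"
      using v(1,2) by (metis carrier_vecD eq_vecI index_zero_vec)
    then show ?thesis unfolding V_def by (intro sum_pos2[of _ k]) auto
  qed
  ultimately have "\<sigma>\<^sup>2 \<le> b" by simp
  then show ?thesis by (rule real_le_rsqrt)
qed

theorem theorem3:
  fixes m s :: nat and X :: "circle set" and x :: "nat \<Rightarrow> circle" and \<tau> :: real
  assumes "0 < m" and "0 < s" and "s \<le> m"
    and "card X = s"
    and "bij_betw x {..<s} X"
    and "0 < \<tau>" and "\<tau> \<le> 1 / 2"
    and "real m > 1 / \<tau>"
  shows "largest_singular_value (fourier_matrix m s x)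
           \<le> sqrt (real (local_sparsity \<tau> X) * (real m + 1 / \<tau>))"
proof -
  let ?A = "fourier_matrix m s x"
  have A: "?A \<in> carrier_mat m s" by (simp add: fourier_matrix_def)
  have "(\<Sum>j<m. (cmod (\<Sum>k<s. ?A $$ (j, k) * v k))\<^sup>2)
      \<le> real (local_sparsity \<tau> X) * (real m + 1 / \<tau>) * (\<Sum>k<s. (cmod (v k))\<^sup>2)" for v
    using fourier_matrix_norm_bound[OF assms(5,6), where m = m and v = v] by (simp add: fourier_matrix_def)
  then have "\<sigma> \<le> sqrt (real (local_sparsity \<tau> X) * (real m + 1 / \<tau>))" if "\<sigma> \<in> singular_values ?A" for \<sigma>
    using singular_value_le[OF A that] by simp
  \<comment> \<open>\<open>Max\<close> is taken over a finite set that is nonempty because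
    \<open>0 < s\<close>, so a bound on every singular value suffices.\<close>
  then show ?thesis
    unfolding largest_singular_value_def
    using singular_values_nonempty[of ?A] A \<open>0 < s\<close> by (simp add: finite_singular_values)
qed

end
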